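(* For $u,v$ positive integers or $\infty$, let $r_{u,v}(n,m)$ be the number of Rota-Baxter words of degree $n$ and arity $m$ in the set $R_{u,v}$ of Rota-Baxter words with one operator $P$ of exponent $u$ and one generator $x$ of exponent $v$, and let $\mathbf R_{u,v}(z,t)=\sum_{n=0}^\infty\sum_{m=0}^\infty r_{u,v}(n,m)z^nt^m$. Then for all $1\le u,v\le\infty$, as formal power series: (1) $\mathbf R_{u,1}(z,t)=\mathbf R_{1,1}\big(\mathbf G_{1,u}(z),\,t\big)$; (2) $\mathbf R_{1,v}(z,t)=\mathbf R_{1,1}\big(z,\,\mathbf G_{1,v}(t)\big)$; (3) $\mathbf R_{u,v}(z,t)=\mathbf R_{1,1}\big(\mathbf G_{1,u}(z),\,\mathbf G_{1,v}(t)\big)$.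
   Context: A Rota-Baxter word (in one generator $x$ and one operator $P=\lfloor\ \rfloor$) is either the empty word $\emptyset$ (of degree $0$ and arity $0$) or a nonempty finite string over $x,\lfloor,\rfloor$ such that the brackets are balanced (equally many $\lfloor$ and $\rfloor$, every prefix having at least as many $\lfloor$ as $\rfloor$) and neither $\rfloor\lfloor$ nor $\lfloor\rfloor$ occurs as a substring. The degree of a word is its number of matched pairs of brackets; its arity is the number of $x$'s in it, counted with multiplicity. An $x$-run in a word is a maximal block of consecutive $x$'s. A $P$-run is a maximal chain of immediately nested matched pairs of brackets (a pair is immediately nested in another if the content of the outer pair is exactly the inner pair together with its content); its length is the number of pairs in the chain. For $u,v$ positive integers or $\infty$, $R_{u,v}$ is the set of Rota-Baxter words in which every $P$-run has length $\le u$ and every $x$-run has length $\le v$. $\mathbf G_{1,v}(t)=t\,\frac{1-t^v}{1-t}$ for finite $v$, and $\mathbf G_{1,\infty}(t)=\frac{t}{1-t}$. *)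

theory Defs
  imports
    "HOL-Computational_Algebra.Formal_Power_Series"
    "HOL-Library.Extended_Nat"
    "HOL-Library.Sublist"
begin

datatype letter = X | LB | RB

definition balanced :: "letter list \<Rightarrow> bool" where
  "balanced w \<longleftrightarrow> count_list w LB = count_list w RB \<and>
     (\<forall>p. prefix p w \<longrightarrow> count_list p RB \<le> count_list p LB)"

(* The library's sublist means contiguous sublist, i.e. substring.
   The empty word satisfies all three conditions. *)
definition RB_word :: "letter list \<Rightarrow> bool" where
  "RB_word w \<longleftrightarrow> balanced w \<and> \<not> sublist [RB, LB] w \<and> \<not> sublist [LB, RB] w"

(* A matched pair is recorded by the positions (i, j) of its left and right bracket. *)
definition matched_pairs :: "letter list \<Rightarrow> (nat \<times> nat) set" where
  "matched_pairs w = {(i, j). i < j \<and> j < length w \<and> w ! i = LB \<and> w ! j = RB \<and>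
     balanced (take (j - Suc i) (drop (Suc i) w))}"

definition degree :: "letter list \<Rightarrow> nat" where
  "degree w = card (matched_pairs w)"

definition arity :: "letter list \<Rightarrow> nat" where
  "arity w = count_list w X"

definition x_run_length :: "letter list \<Rightarrow> nat \<Rightarrow> bool" where
  "x_run_length w k \<longleftrightarrow> k > 0 \<and>
     (\<exists>a b. w = a @ replicate k X @ b \<and>
            (a \<noteq> [] \<longrightarrow> last a \<noteq> X) \<and> (b \<noteq> [] \<longrightarrow> hd b \<noteq> X))"

(* The pair q is immediately nested in p: nothing lies between the two left brackets
   and nothing lies between the two right brackets. *)
definition immediately_nested :: "nat \<times> nat \<Rightarrow> nat \<times> nat \<Rightarrow> bool" where
  "immediately_nested p q \<longleftrightarrow> fst q = Suc (fst p) \<and> snd p = Suc (snd q)"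

(* Chains are listed from the outermost pair to the innermost one. *)
definition P_chain :: "letter list \<Rightarrow> (nat \<times> nat) list \<Rightarrow> bool" where
  "P_chain w ps \<longleftrightarrow> ps \<noteq> [] \<and> set ps \<subseteq> matched_pairs w \<and> successively immediately_nested ps"

definition P_run :: "letter list \<Rightarrow> (nat \<times> nat) list \<Rightarrow> bool" where
  "P_run w ps \<longleftrightarrow> P_chain w ps \<and> (\<forall>qs. P_chain w qs \<and> sublist ps qs \<longrightarrow> qs = ps)"

definition RB_words :: "enat \<Rightarrow> enat \<Rightarrow> letter list set" where
  "RB_words u v = {w. RB_word w \<and> (\<forall>ps. P_run w ps \<longrightarrow> enat (length ps) \<le> u) \<and>
     (\<forall>k. x_run_length w k \<longrightarrow> enat k \<le> v)}"

definition r_count :: "enat \<Rightarrow> enat \<Rightarrow> nat \<Rightarrow> nat \<Rightarrow> nat" where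
  "r_count u v n m = card {w \<in> RB_words u v. degree w = n \<and> arity w = m}"

(* A power series in z and t is a series in z whose coefficients are series in t. *)
definition R_gf :: "enat \<Rightarrow> enat \<Rightarrow> rat fps fps" where
  "R_gf u v = Abs_fps (\<lambda>n. Abs_fps (\<lambda>m. of_nat (r_count u v n m)))"

definition G1 :: "enat \<Rightarrow> rat fps" where
  "G1 v = (case v of
      enat k \<Rightarrow> fps_X * ((1 - fps_X ^ k) / (1 - fps_X))
    | \<infinity> \<Rightarrow> fps_X / (1 - fps_X))"

(* fps_in_z A is A(z) as a series in z and t; fps_subst2 F A B is F(A(z), B(t)), which is
   meaningful when A and B have constant term 0 (see fps_subst2_nth). *)
definition fps_in_z :: "'a::comm_ring_1 fps \<Rightarrow> 'a fps fps" where
  "fps_in_z A = Abs_fps (\<lambda>n. fps_const (fps_nth A n))"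

definition fps_subst2 :: "'a::comm_ring_1 fps fps \<Rightarrow> 'a fps \<Rightarrow> 'a fps \<Rightarrow> 'a fps fps" where
  "fps_subst2 F A B =
     fps_compose (Abs_fps (\<lambda>n. fps_compose (fps_nth F n) B)) (fps_in_z A)"

lemma fps_in_z_mult: "fps_in_z (A * B) = fps_in_z A * fps_in_z B"
proof (rule fps_ext)
  fix n
  have "fps_const (\<Sum>i\<in>S. h i) = (\<Sum>i\<in>S. fps_const (h i))" for S :: "nat set" and h :: "nat \<Rightarrow> 'a"
    by (induction S rule: infinite_finite_induct) (simp_all flip: fps_const_add)
  then show "fps_nth (fps_in_z (A * B)) n = fps_nth (fps_in_z A * fps_in_z B) n"
    by (simp add: fps_in_z_def fps_mult_nth)
qed

lemma fps_in_z_power: "fps_in_z (A ^ i) = fps_in_z A ^ i"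
proof (induction i)
  case 0
  show ?case by (rule fps_ext) (simp add: fps_in_z_def)
qed (simp add: fps_in_z_mult)

lemma fps_subst2_nth:
  "fps_nth (fps_nth (fps_subst2 F A B) n) m =
     (\<Sum>i=0..n. \<Sum>j=0..m. fps_nth (fps_nth F i) j * fps_nth (A ^ i) n * fps_nth (B ^ j) m)"
proof -
  have "fps_nth (fps_nth (fps_subst2 F A B) n) m =
     (\<Sum>i=0..n. fps_nth (fps_compose (fps_nth F i) B) m * fps_nth (A ^ i) n)"
    unfolding fps_subst2_def fps_compose_nth[of _ "fps_in_z A"]
    by (simp add: fps_sum_nth flip: fps_in_z_power) (simp add: fps_in_z_def)
  also have "\<dots> = (\<Sum>i=0..n. \<Sum>j=0..m.
      fps_nth (fps_nth F i) j * fps_nth (A ^ i) n * fps_nth (B ^ j) m)"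
    by (simp add: fps_compose_nth sum_distrib_right sum_distrib_left mult_ac)
  finally show ?thesis .
qed

end

theory Submission
  imports Defs
begin

text \<open>
  Collapsing every \<open>P\<close>-run of a Rota-Baxter word to a single pair of brackets and every
  \<open>x\<close>-run to a single \<open>x\<close> gives a word of \<open>R\<^bsub>1,1\<^esub>\<close>, the skeleton of the word. If the skeleton
  has degree \<open>i\<close> and arity \<open>j\<close>, the word is recovered from it by choosing, independently and
  freely, a length in \<open>[1,u]\<close> for each of the \<open>i\<close> pairs and a length in \<open>[1,v]\<close> for each of the
  \<open>j\<close> letters; the degree and the arity of the word are the sums of these lengths. The choices
  for the pairs contribute \<open>G\<^bsub>1,u\<^esub>(z)\<^sup>i\<close> to the generating function, those for the letters
  \<open>G\<^bsub>1,v\<^esub>(t)\<^sup>j\<close>, and summing over all skeletons is the substitution in the identity for general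
  \<open>u\<close> and \<open>v\<close>. The other two identities are its cases \<open>v = 1\<close> and \<open>u = 1\<close>, because \<open>G\<^bsub>1,1\<^esub>(t) = t\<close>.

  To make the collapse precise, words are parsed into trees whose nodes are the runs, each
  labelled with its length. Lemmas \<open>word_surj\<close> and \<open>word_inject\<close> say that a word has exactly one
  parse tree with maximal runs. That the labels of the tree bound all runs of the word
  (\<open>word_in_RB_words_iff\<close>) rests on two facts about strings: a \<open>P\<close>-chain of length \<open>k\<close> is the
  same as a factor \<open>LB\<^sup>k c RB\<^sup>k\<close> with balanced \<open>c\<close> (\<open>P_chain_iff_nest\<close>), and such a factor of
  a concatenation of balanced words lies in one of the parts (\<open>nest_factor_append\<close>). The
  counting is then \<open>card_blocks_of_size\<close>, with \<open>G1_power_nth\<close> for the number of label lists.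
\<close>

section \<open>Balanced words\<close>

lemma balanced_Nil [simp]: "balanced []"
  by (simp add: balanced_def)

lemma balanced_count: "balanced w \<Longrightarrow> count_list w RB = count_list w LB"
  by (simp add: balanced_def)

lemma balanced_prefix: "balanced (a @ b) \<Longrightarrow> count_list a RB \<le> count_list a LB"
  by (simp add: balanced_def)

lemma balanced_suffix: "balanced (a @ b) \<Longrightarrow> count_list b LB \<le> count_list b RB"
  using balanced_count[of "a @ b"] balanced_prefix[of a b] by simp

lemma balanced_append: "balanced a \<Longrightarrow> balanced b \<Longrightarrow> balanced (a @ b)"
  by (auto simp: balanced_def prefix_append)

lemma balanced_append_iff: "balanced a \<Longrightarrow> balanced (a @ b) \<longleftrightarrow> balanced b"
proof
  assume a: "balanced a" and ab: "balanced (a @ b)"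
  have "count_list p RB \<le> count_list p LB" if p: "prefix p b" for p
  proof -
    obtain q where "b = p @ q" using p by (auto simp: prefix_def)
    then show ?thesis using balanced_prefix[of "a @ p" q] ab balanced_count[OF a] by simp
  qed
  then show "balanced b"
    using balanced_count[OF a] balanced_count[OF ab] by (simp add: balanced_def)
qed (rule balanced_append)

lemma balanced_X_Cons: "balanced (X # w) \<longleftrightarrow> balanced w"
proof -
  have "balanced [X]" by (auto simp: balanced_def prefix_Cons)
  then show ?thesis using balanced_append_iff[of "[X]" w] by simp
qed

lemma balanced_replicate_X: "balanced (replicate k X)"
  by (induction k) (simp_all add: balanced_X_Cons)

lemma balanced_bracket: 
  assumes "balanced c" shows "balanced (LB # c @ [RB])"
proof -
  have "count_list p RB \<le> count_list p LB" if p: "prefix p (LB # c @ [RB])" for p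
  proof -
    consider "p = []" | q where "p = LB # q" "prefix q c" | "p = LB # c @ [RB]"
      using p by (auto simp: prefix_Cons prefix_append)
    then show ?thesis
      using assms by cases (auto simp: balanced_def)
  qed
  then show ?thesis using balanced_count[OF assms] by (simp add: balanced_def)
qed

lemma balanced_bracket_append:
  "balanced c \<Longrightarrow> balanced (LB # c @ RB # b) \<longleftrightarrow> balanced b"
  using balanced_append_iff[OF balanced_bracket, of c b] by simp

lemma not_balanced_RB: "balanced d \<Longrightarrow> \<not> balanced (d @ RB # e)"
  using balanced_prefix[of "d @ [RB]" e] balanced_count[of d] by auto

lemma balanced_hd: "balanced w \<Longrightarrow> w \<noteq> [] \<Longrightarrow> hd w \<noteq> RB"
  using not_balanced_RB[of "[]" "tl w"] by (cases w) auto

lemma balanced_last: "balanced w \<Longrightarrow> w \<noteq> [] \<Longrightarrow> last w \<noteq> LB"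
  using balanced_suffix[of "butlast w" "[last w]"] by auto

text \<open>
  Reading from the left, the nesting level of \<open>r\<close> ends below zero; the first right bracket that
  takes it there has a balanced word before it. An initial left bracket has to be closed before
  that, so in this case the induction hypothesis is used twice.
\<close>
lemma first_return_exists:
  "count_list r LB < count_list r RB \<Longrightarrow> \<exists>c b. r = c @ RB # b \<and> balanced c"
proof (induction r rule: length_induct)
  case (1 r)
  then obtain y r' where r: "r = y # r'" by (cases r) auto
  show ?case
  proof (cases y)
    case X
    then obtain c b where "r' = c @ RB # b" "balanced c"
      using 1 r by auto
    then have "r = (X # c) @ RB # b" "balanced (X # c)"
      using r X by (auto simp: balanced_X_Cons)
    then show ?thesis by blast
  next
    case LB
    have "count_list r' LB < count_list r' RB" using 1 r LB by simp
    then obtain c b where c: "r' = c @ RB # b" "balanced c"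
      using 1 r by auto
    have "count_list b LB < count_list b RB"
      using 1(2) r LB c balanced_count[OF c(2)] by simp
    moreover have "length b < length r" using r c by simp
    ultimately obtain d e where d: "b = d @ RB # e" "balanced d"
      using 1 by blast
    have "r = (LB # c @ RB # d) @ RB # e" "balanced (LB # c @ RB # d)"
      using r LB c d balanced_bracket_append by auto
    then show ?thesis by blast
  next
    case RB
    then have "r = [] @ RB # r'" using r by simp
    then show ?thesis using balanced_Nil by blast
  qed
qed

text \<open>
  Otherwise one of \<open>c\<close> and \<open>d\<close> would have the other one followed by a right bracket as a
  prefix, against balancedness.
\<close>
lemma first_return_unique:
  assumes "c @ RB # b = d @ RB # e" "balanced c" "balanced d"
  shows "c = d \<and> b = e"
proof -
  obtain us where "c = d @ us \<and> us @ RB # b = RB # e \<or> c @ us = d \<and> RB # b = us @ RB # e"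
    using assms(1) by (auto simp: append_eq_append_conv2)
  then show ?thesis
    using assms(2,3) not_balanced_RB[of d] not_balanced_RB[of c]
    by (cases us) auto
qed

lemma matching_bracket_exists:
  assumes "balanced (a @ LB # r)"
  shows "\<exists>c b. r = c @ RB # b \<and> balanced c"
  using balanced_suffix[OF assms] by (intro first_return_exists) simp

text \<open>
  Matched pairs as factorizations of the word: this replaces arithmetic on positions by
  cancellation in strings.
\<close>
lemma matched_pairs_iff:
  "(i, j) \<in> matched_pairs w \<longleftrightarrow>
     (\<exists>a c b. w = a @ LB # c @ RB # b \<and> balanced c \<and> i = length a \<and> j = Suc (length (a @ c)))"
proof
  assume "(i, j) \<in> matched_pairs w"
  then have *: "i < j" "j < length w" "w ! i = LB" "w ! j = RB"
    and bal: "balanced (take (j - Suc i) (drop (Suc i) w))"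
    by (auto simp: matched_pairs_def)
  define c where "c = take (j - Suc i) (drop (Suc i) w)"
  have "drop (Suc i) w = c @ drop (j - Suc i) (drop (Suc i) w)"
    unfolding c_def by (rule append_take_drop_id[symmetric])
  also have "drop (j - Suc i) (drop (Suc i) w) = RB # drop (Suc j) w"
    using * Cons_nth_drop_Suc[of j w] by simp
  finally have "w = take i w @ LB # c @ RB # drop (Suc j) w"
    using * id_take_nth_drop[of i w] by simp
  then show "\<exists>a c b. w = a @ LB # c @ RB # b \<and> balanced c \<and> i = length a \<and> j = Suc (length (a @ c))"
    using bal * by (intro exI[of _ "take i w"] exI[of _ c] exI[of _ "drop (Suc j) w"])
      (auto simp: c_def)
next
  assume "\<exists>a c b. w = a @ LB # c @ RB # b \<and> balanced c \<and> i = length a \<and> j = Suc (length (a @ c))"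
  then show "(i, j) \<in> matched_pairs w"
    by (auto simp: matched_pairs_def nth_append)
qed

text \<open>
  Every left bracket of a balanced word has exactly one partner, by existence and uniqueness of
  the first return.
\<close>
lemma degree_eq_count:
  assumes "balanced w" shows "degree w = count_list w LB"
proof -
  have "inj_on fst (matched_pairs w)"
  proof (rule inj_onI)
    fix p q assume "p \<in> matched_pairs w" "q \<in> matched_pairs w" and eq: "fst p = fst q"
    then obtain a c b a' c' b' where
      p: "w = a @ LB # c @ RB # b" "balanced c" "p = (length a, Suc (length (a @ c)))" and
      q: "w = a' @ LB # c' @ RB # b'" "balanced c'" "q = (length a', Suc (length (a' @ c')))"
      by (cases p; cases q) (auto simp: matched_pairs_iff)
    have "length a = length a'" using p(3) q(3) eq by simp
    moreover have "a @ LB # c @ RB # b = a' @ LB # c' @ RB # b'" using p(1) q(1) by simp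
    ultimately have "a = a'" "c @ RB # b = c' @ RB # b'" by simp_all
    then show "p = q" using first_return_unique[of c b c' b'] p(2,3) q(2,3) by simp
  qed
  moreover have "fst ` matched_pairs w = {i. i < length w \<and> w ! i = LB}"
  proof (intro equalityI subsetI)
    fix i assume "i \<in> {i. i < length w \<and> w ! i = LB}"
    then have w: "w = take i w @ LB # drop (Suc i) w" "i < length w"
      using id_take_nth_drop[of i w] by auto
    then obtain c b where "drop (Suc i) w = c @ RB # b" "balanced c"
      using matching_bracket_exists[of "take i w" "drop (Suc i) w"] assms by auto
    then have "(i, Suc (length (take i w @ c))) \<in> matched_pairs w"
      unfolding matched_pairs_iff using w
      by (intro exI[of _ "take i w"] exI[of _ c] exI[of _ b]) simp
    then show "i \<in> fst ` matched_pairs w" by force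
  qed (auto simp: matched_pairs_def)
  ultimately have "degree w = card {i. i < length w \<and> w ! i = LB}"
    unfolding degree_def by (metis card_image)
  also have "\<dots> = length (filter (\<lambda>y. y = LB) w)"
    by (simp add: length_filter_conv_card)
  also have "\<dots> = count_list w LB"
    unfolding count_list_eq_length_filter by (rule arg_cong[of _ _ length], rule filter_cong) auto
  finally show ?thesis .
qed

section \<open>Runs as factors\<close>

text \<open>
  The factor spanned by a chain of \<open>k\<close> immediately nested pairs with innermost content \<open>c\<close>.
\<close>
definition nest :: "nat \<Rightarrow> letter list \<Rightarrow> letter list" where
  "nest k c = replicate k LB @ c @ replicate k RB"

lemma nest_0 [simp]: "nest 0 c = c"
  by (simp add: nest_def)

lemma nest_Suc: "nest (Suc k) c = LB # nest k c @ [RB]"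
  by (simp add: nest_def replicate_append_same)

lemma nest_nest: "nest (k + l) c = nest k (nest l c)"
  by (induction k) (simp_all add: nest_Suc)

lemma nest_inject: "nest k c = nest k d \<longleftrightarrow> c = d"
  by (simp add: nest_def)

lemma nest_eq_nest: "nest k c = nest l d \<Longrightarrow> k \<le> l \<Longrightarrow> c = nest (l - k) d"
  using nest_nest[of k "l - k" d] by (simp add: nest_inject)

lemma balanced_nest: "balanced c \<Longrightarrow> balanced (nest k c)"
  by (induction k) (simp_all add: nest_Suc balanced_bracket)

text \<open>
  A nest is closed by the partner of its first bracket, so its end is determined by the first
  return.
\<close>
lemma nest_append_eq:
  assumes "nest k c @ b = nest l d @ e" "0 < k" "0 < l" "balanced c" "balanced d"
  shows "nest k c = nest l d \<and> b = e"
proof -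
  obtain k' l' where "k = Suc k'" "l = Suc l'" using assms by (auto dest!: gr0_implies_Suc)
  then show ?thesis
    using first_return_unique[of "nest k' c" b "nest l' d" e] assms
    by (auto simp: nest_Suc balanced_nest)
qed

text \<open>
  A nest cannot straddle the end of a balanced word: the part of it inside \<open>w\<close> would be a
  nonempty proper prefix of the nest, which has more left than right brackets, and at the same
  time a suffix of a balanced word, which never has.
\<close>
lemma nest_factor_append:
  assumes eq: "w @ w' = a @ nest k c @ b" and "balanced w" "balanced c" "0 < k"
  shows "(\<exists>b'. w = a @ nest k c @ b') \<or> (\<exists>a'. w' = a' @ nest k c @ b)"
proof -
  obtain us where "w = a @ us \<and> us @ w' = nest k c @ b \<or> w @ us = a \<and> w' = us @ nest k c @ b"
    using eq by (auto simp: append_eq_append_conv2)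
  then consider (later) "w' = us @ nest k c @ b"
    | (overlap) "w = a @ us" "us @ w' = nest k c @ b" by blast
  then show ?thesis
  proof cases
    case overlap
    then obtain vs where "us = nest k c @ vs \<or> us @ vs = nest k c \<and> w' = vs @ b"
      by (auto simp: append_eq_append_conv2)
    then consider "us = nest k c @ vs" | (proper) "us @ vs = nest k c" "w' = vs @ b" by blast
    then show ?thesis
    proof cases
      case proper
      show ?thesis
      proof (cases "us = [] \<or> vs = []")
        case True
        then show ?thesis using overlap proper by auto
      next
        case False
        obtain k' where k: "k = Suc k'" using \<open>0 < k\<close> by (auto dest!: gr0_implies_Suc)
        obtain us' where us: "us = LB # us'" "us' @ vs = nest k' c @ [RB]"
          using False proper by (cases us) (auto simp: k nest_Suc)
        \<comment> \<open>\<open>us'\<close> is a prefix of a balanced word, so \<open>us = LB # us'\<close> has a surplus of left brackets\<close>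
        then have "us' @ butlast vs = nest k' c"
          using False by (metis butlast_append butlast_snoc)
        then have "count_list us' RB \<le> count_list us' LB"
          using balanced_prefix[of us' "butlast vs"] balanced_nest[OF \<open>balanced c\<close>] by simp
        then show ?thesis
          using balanced_suffix[of a us] overlap \<open>balanced w\<close> us by simp
      qed
    qed (use overlap in auto)
  qed auto
qed

text \<open>
  Peeling off the outer brackets one at a time: a factor that uses the outermost left bracket
  must end with its partner and is then everything; any other factor lies inside.
\<close>
lemma nest_factor_nest:
  assumes "nest l d = a @ nest k c @ b" "balanced d" "balanced c" "0 < k"
  shows "(\<exists>l'\<le>l. nest l' d = nest k c) \<or> (\<exists>a' b'. d = a' @ nest k c @ b')"
  using assms(1)
proof (induction l arbitrary: a b)
  case (Suc l)
  obtain k' where k: "k = Suc k'" using \<open>0 < k\<close> by (auto dest!: gr0_implies_Suc)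
  show ?case
  proof (cases a)
    case Nil
    then have "nest l d @ RB # [] = nest k' c @ RB # b"
      using Suc.prems by (simp add: nest_Suc k)
    then have "nest l d = nest k' c"
      using first_return_unique assms balanced_nest by blast
    then have "nest (Suc l) d = nest k c" by (simp add: nest_Suc k)
    then show ?thesis by blast
  next
    case (Cons y a')
    then have "nest l d @ [RB] = a' @ nest k c @ b"
      using Suc.prems by (simp add: nest_Suc)
    then consider b' where "nest l d = a' @ nest k c @ b'" | a'' where "[RB] = a'' @ nest k c @ b"
      using nest_factor_append assms balanced_nest by blast
    then show ?thesis
    proof cases
      case 1
      then show ?thesis using Suc.IH le_Suc_eq by blast
    next
      case 2
      then show ?thesis by (auto simp: k nest_Suc Cons_eq_append_conv)
    qed
  qed
qed auto

text \<open>
  The chain is read from its innermost pair outwards, each further pair adding one bracket on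
  either side; the positions of the outermost pair are carried along so that the next pair can be
  attached.
\<close>
lemma P_chain_imp_nest:
  assumes "successively immediately_nested ((i, j) # ps)" "set ((i, j) # ps) \<subseteq> matched_pairs w"
  shows "\<exists>a c b. w = a @ nest (Suc (length ps)) c @ b \<and> balanced c \<and>
           length a = i \<and> length (a @ nest (Suc (length ps)) c) = Suc j"
  using assms
proof (induction ps arbitrary: i j)
  case Nil
  then obtain a c b where "w = a @ LB # c @ RB # b" "balanced c" "i = length a" "j = Suc (length (a @ c))"
    by (auto simp: matched_pairs_iff)
  then show ?case
    by (intro exI[of _ a] exI[of _ c] exI[of _ b]) (auto simp: nest_Suc)
next
  case (Cons q ps)
  obtain i' j' where q: "q = (i', j')" by (cases q)
  have ij: "i' = Suc i" "j = Suc j'"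
    using Cons.prems q by (auto simp: immediately_nested_def)
  obtain a c b where w: "w = a @ nest (Suc (length ps)) c @ b" "balanced c"
    "length a = Suc i" "length (a @ nest (Suc (length ps)) c) = j"
    using Cons.IH[of i' j'] Cons.prems q ij by auto
  have lts: "w ! i = LB" "w ! j = RB" "j < length w"
    using Cons.prems by (auto simp: matched_pairs_def)
  obtain a' where a: "a = a' @ [LB]"
    using w lts by (cases a rule: rev_cases) (auto simp: nth_append)
  obtain b' where b: "b = RB # b'"
    using w lts by (cases b) (auto simp: nth_append)
  show ?case
    using w a b by (intro exI[of _ a'] exI[of _ c] exI[of _ b']) (auto simp: nest_Suc)
qed

lemma nest_imp_P_chain:
  assumes "w = a @ nest (Suc k) c @ b" "balanced c"
  shows "\<exists>ps. P_chain w ((length a, length a + 2 * k + Suc (length c)) # ps) \<and> length ps = k"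
  using assms(1)
proof (induction k arbitrary: a b)
  case 0
  then have "(length a, Suc (length a + length c)) \<in> matched_pairs w"
    using assms(2) by (auto simp: matched_pairs_iff nest_Suc)
  then show ?case by (intro exI[of _ "[]"]) (auto simp: P_chain_def)
next
  case (Suc k)
  have "w = (a @ [LB]) @ nest (Suc k) c @ RB # b"
    using Suc.prems by (simp add: nest_Suc)
  then obtain ps where ps: "length ps = k"
    "P_chain w ((length (a @ [LB]), length (a @ [LB]) + 2 * k + Suc (length c)) # ps)"
    using Suc.IH by blast
  have "(length a, length a + 2 * Suc k + Suc (length c)) \<in> matched_pairs w"
    unfolding matched_pairs_iff
  proof (intro exI conjI)
    show "w = a @ LB # nest (Suc k) c @ RB # b"
      using Suc.prems by (simp add: nest_Suc)
  qed (use balanced_nest[OF assms(2), of "Suc k"] in \<open>simp_all add: nest_def\<close>)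
  then show ?case
    using ps by (intro exI[of _ "(length (a @ [LB]), length (a @ [LB]) + 2 * k + Suc (length c)) # ps"])
      (auto simp: P_chain_def immediately_nested_def)
qed

lemma P_chain_iff_nest:
  assumes "0 < k"
  shows "(\<exists>ps. P_chain w ps \<and> length ps = k) \<longleftrightarrow> (\<exists>a c b. w = a @ nest k c @ b \<and> balanced c)"
proof
  assume "\<exists>ps. P_chain w ps \<and> length ps = k"
  then obtain i j ps where "P_chain w ((i, j) # ps)" "k = Suc (length ps)"
    using assms by (metis P_chain_def list.exhaust length_Cons surj_pair)
  then show "\<exists>a c b. w = a @ nest k c @ b \<and> balanced c"
    using P_chain_imp_nest[of i j ps w] by (auto simp: P_chain_def)
next
  assume "\<exists>a c b. w = a @ nest k c @ b \<and> balanced c"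
  moreover obtain k' where "k = Suc k'" using assms by (auto dest!: gr0_implies_Suc)
  ultimately show "\<exists>ps. P_chain w ps \<and> length ps = k"
    using nest_imp_P_chain by (metis length_Cons)
qed

lemma P_chain_length_le: 
  assumes "P_chain w ps" shows "length ps \<le> length w"
proof -
  have "0 < length ps" using assms by (auto simp: P_chain_def)
  then obtain a c b where "w = a @ nest (length ps) c @ b"
    using P_chain_iff_nest assms by blast
  then show ?thesis by (auto simp: nest_def dest: arg_cong[of _ _ length])
qed

text \<open>
  Every chain extends to a maximal one, since the length of the word bounds the length of chains;
  hence bounding the runs is the same as bounding all chains. This removes maximality from the
  description of \<open>R\<^bsub>u,v\<^esub>\<close>.
\<close>
lemma P_runs_bounded_iff:
  "(\<forall>ps. P_run w ps \<longrightarrow> enat (length ps) \<le> u) \<longleftrightarrow>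
     (\<forall>k a c b. 0 < k \<longrightarrow> w = a @ nest k c @ b \<longrightarrow> balanced c \<longrightarrow> enat k \<le> u)"
  (is "?L \<longleftrightarrow> ?R")
proof
  assume R: ?R
  show ?L
  proof (intro allI impI)
    fix ps assume "P_run w ps"
    then have "P_chain w ps" "0 < length ps" by (auto simp: P_run_def P_chain_def)
    then obtain a c b where "w = a @ nest (length ps) c @ b" "balanced c"
      using P_chain_iff_nest[of "length ps" w] by blast
    then show "enat (length ps) \<le> u" using R \<open>0 < length ps\<close> by blast
  qed
next
  assume L: ?L
  show ?R
  proof (intro allI impI)
    fix k a c b assume "0 < k" "w = a @ nest k c @ b" "balanced c"
    then obtain ps where ps: "P_chain w ps" "length ps = k"
      using P_chain_iff_nest[of k w] by blast
    \<comment> \<open>a longest chain containing \<open>ps\<close> is a run\<close>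
    define Q where "Q = (\<lambda>n. \<exists>qs. P_chain w qs \<and> sublist ps qs \<and> length qs = n)"
    have "Q k" using ps by (auto simp: Q_def)
    moreover have bd: "\<forall>n. Q n \<longrightarrow> n \<le> length w" using P_chain_length_le by (auto simp: Q_def)
    ultimately have "Q (Greatest Q)" using GreatestI_nat[of Q k "length w"] by blast
    then obtain qs where qs: "P_chain w qs" "sublist ps qs" "length qs = Greatest Q"
      by (auto simp: Q_def)
    have "P_run w qs"
      unfolding P_run_def
    proof (intro conjI allI impI qs(1))
      fix rs assume rs: "P_chain w rs \<and> sublist qs rs"
      then have "Q (length rs)" using qs sublist_order.order.trans by (auto simp: Q_def)
      then have "length rs \<le> length qs" using Greatest_le_nat bd qs(3) by metis
      then show "rs = qs"
        using rs by (auto simp: sublist_def)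
    qed
    then have "enat (length qs) \<le> u" using L by blast
    moreover have "k \<le> length qs" using qs(2) ps(2) by (auto dest: sublist_length_le)
    ultimately show "enat k \<le> u" using order_trans by (metis enat_ord_simps(1))
  qed
qed

lemma split_trailing: "\<exists>b k. w = b @ replicate k x \<and> (b \<noteq> [] \<longrightarrow> last b \<noteq> x)"
proof (induction w rule: rev_induct)
  case Nil
  show ?case by (intro exI[of _ "[]"] exI[of _ 0]) simp
next
  case (snoc y w)
  then obtain b k where b: "w = b @ replicate k x" "b \<noteq> [] \<longrightarrow> last b \<noteq> x" by blast
  show ?case
  proof (cases "y = x")
    case True
    then have "w @ [y] = b @ replicate (Suc k) x"
      using b(1) by (simp add: replicate_append_same)
    then show ?thesis using b(2) by (intro exI[of _ b] exI[of _ "Suc k"] conjI)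
  next
    case False
    then show ?thesis by (intro exI[of _ "w @ [y]"] exI[of _ 0]) simp
  qed
qed

lemma split_leading: "\<exists>b k. w = replicate k x @ b \<and> (b \<noteq> [] \<longrightarrow> hd b \<noteq> x)"
proof -
  obtain b k where "rev w = b @ replicate k x" "b \<noteq> [] \<longrightarrow> last b \<noteq> x"
    using split_trailing[of "rev w" x] by blast
  moreover from this(1) have "w = replicate k x @ rev b"
    by (metis rev_append rev_replicate rev_rev_ident)
  ultimately have "w = replicate k x @ rev b" "rev b \<noteq> [] \<longrightarrow> hd (rev b) \<noteq> x"
    by (simp_all add: hd_rev)
  then show ?thesis by blast
qed

text \<open>
  As for \<open>P\<close>-runs: a block of \<open>x\<close>'s extends on both sides to a maximal one.
\<close>
lemma x_runs_bounded_iff: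
  "(\<forall>k. x_run_length w k \<longrightarrow> enat k \<le> v) \<longleftrightarrow> (\<forall>k. 0 < k \<longrightarrow> sublist (replicate k X) w \<longrightarrow> enat k \<le> v)"
  (is "?L \<longleftrightarrow> ?R")
proof
  assume L: ?L
  show ?R
  proof (intro allI impI)
    fix k :: nat assume "0 < k" "sublist (replicate k X) w"
    then obtain a b where w: "w = a @ replicate k X @ b" by (auto simp: sublist_def)
    obtain a' i where a: "a = a' @ replicate i X" "a' \<noteq> [] \<longrightarrow> last a' \<noteq> X"
      using split_trailing[of a X] by blast
    obtain b' j where b: "b = replicate j X @ b'" "b' \<noteq> [] \<longrightarrow> hd b' \<noteq> X"
      using split_leading[of b X] by blast
    have "w = a' @ replicate (i + k + j) X @ b'"
      using w a b by (simp add: replicate_add)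
    then have "x_run_length w (i + k + j)"
      using a b \<open>0 < k\<close> unfolding x_run_length_def by auto
    then have "enat (i + k + j) \<le> v" using L by blast
    moreover have "enat k \<le> enat (i + k + j)" by simp
    ultimately show "enat k \<le> v" using order_trans by blast
  qed
qed (auto simp: x_run_length_def sublist_def)

definition may_precede :: "letter \<Rightarrow> letter \<Rightarrow> bool" where
  "may_precede y z \<longleftrightarrow> \<not> (y = RB \<and> z = LB) \<and> \<not> (y = LB \<and> z = RB)"

lemma sublist_pair_iff: "\<not> sublist [y, z] w \<longleftrightarrow> successively (\<lambda>p q. \<not> (p = y \<and> q = z)) w"
  by (induction w rule: induct_list012) (auto simp: sublist_Cons_right)

text \<open>
  As a condition on consecutive letters, the exclusion of factors splits along concatenation and
  cons.
\<close>
lemma RB_word_iff: "RB_word w \<longleftrightarrow> balanced w \<and> successively may_precede w"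
proof -
  have "successively may_precede w \<longleftrightarrow>
     successively (\<lambda>p q. \<not> (p = RB \<and> q = LB)) w \<and> successively (\<lambda>p q. \<not> (p = LB \<and> q = RB)) w"
    by (induction w rule: induct_list012) (auto simp: may_precede_def)
  then show ?thesis by (simp add: RB_word_def sublist_pair_iff)
qed

section \<open>Words as labelled trees\<close>

text \<open>
  A word is a sequence of blocks. \<open>XBlock k f\<close> stands for \<open>k\<close> letters \<open>x\<close> followed by the
  remaining blocks \<open>f\<close>, and \<open>PBlock k c f\<close> for \<open>k\<close> nested pairs of brackets with content \<open>c\<close>,
  followed by \<open>f\<close>.
\<close>
datatype blocks = Empty | XBlock nat blocks | PBlock nat blocks blocks

fun word :: "blocks \<Rightarrow> letter list" where
  "word Empty = []"
| "word (XBlock k f) = replicate k X @ word f"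
| "word (PBlock k c f) = nest k (word c) @ word f"

fun p_exps :: "blocks \<Rightarrow> nat list" where
  "p_exps Empty = []"
| "p_exps (XBlock k f) = p_exps f"
| "p_exps (PBlock k c f) = k # p_exps c @ p_exps f"

fun x_exps :: "blocks \<Rightarrow> nat list" where
  "x_exps Empty = []"
| "x_exps (XBlock k f) = k # x_exps f"
| "x_exps (PBlock k c f) = x_exps c @ x_exps f"

fun starts_X :: "blocks \<Rightarrow> bool" where
  "starts_X (XBlock k f) = True"
| "starts_X _ = False"

fun starts_P :: "blocks \<Rightarrow> bool" where
  "starts_P (PBlock k c f) = True"
| "starts_P _ = False"

fun single_P :: "blocks \<Rightarrow> bool" where
  "single_P (PBlock k c Empty) = True"
| "single_P _ = False"

text \<open>
  This condition ignores the labels. It excludes adjacent blocks of the same kind (two adjacent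
  \<open>PBlock\<close>s would produce a right bracket followed by a left one), empty brackets, and a content
  consisting of one \<open>PBlock\<close>, which should be merged with the surrounding block.
\<close>
fun maximal_blocks :: "blocks \<Rightarrow> bool" where
  "maximal_blocks Empty = True"
| "maximal_blocks (XBlock k f) = (\<not> starts_X f \<and> maximal_blocks f)"
| "maximal_blocks (PBlock k c f) =
     (c \<noteq> Empty \<and> \<not> single_P c \<and> \<not> starts_P f \<and> maximal_blocks c \<and> maximal_blocks f)"

definition proper :: "blocks \<Rightarrow> bool" where
  "proper f \<longleftrightarrow> maximal_blocks f \<and> 0 \<notin> set (p_exps f) \<and> 0 \<notin> set (x_exps f)"

lemma proper_simps [simp]:
  "proper Empty"
  "proper (XBlock k f) \<longleftrightarrow> 0 < k \<and> \<not> starts_X f \<and> proper f"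
  "proper (PBlock k c f) \<longleftrightarrow>
     0 < k \<and> c \<noteq> Empty \<and> \<not> single_P c \<and> \<not> starts_P f \<and> proper c \<and> proper f"
  by (auto simp: proper_def)

lemma balanced_word: "balanced (word f)"
  by (induction f) (simp_all add: balanced_append balanced_replicate_X balanced_nest)

lemma word_XBlock_Cons: "0 < k \<Longrightarrow> word (XBlock k f) = X # replicate (k - 1) X @ word f"
  by (cases k) auto

lemma word_PBlock_Cons:
  "0 < k \<Longrightarrow> word (PBlock k c f) = LB # nest (k - 1) (word c) @ RB # word f"
  by (cases k) (auto simp: nest_Suc)

lemma word_eq_Nil_iff: "proper f \<Longrightarrow> word f = [] \<longleftrightarrow> f = Empty"
  by (cases f) (auto simp: word_XBlock_Cons word_PBlock_Cons simp del: word.simps(2,3))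

lemma hd_word:
  "proper f \<Longrightarrow> f \<noteq> Empty \<Longrightarrow> hd (word f) = (if starts_X f then X else LB)"
  by (cases f) (auto simp: word_XBlock_Cons word_PBlock_Cons simp del: word.simps(2,3))

lemma starts_X_iff: "starts_X f \<longleftrightarrow> f \<noteq> Empty \<and> \<not> starts_P f"
  by (cases f) auto

text \<open>
  The first bracket of a nest is closed by its last one, so the tree of a word which is a nest has
  a first block that already exhausts the word.
\<close>
lemma single_P_of_word_nest:
  assumes "proper f" "word f = nest (Suc i) c" "balanced c"
  shows "single_P f"
proof (cases f)
  case (PBlock k d g)
  then have "nest k (word d) @ word g = nest (Suc i) c @ []" using assms by simp
  then have "word g = []"
    using nest_append_eq[of k "word d" "word g" "Suc i" c "[]"] assms PBlock
    by (simp add: balanced_word)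
  then show ?thesis using assms PBlock by (simp add: word_eq_Nil_iff)
next
  case (XBlock k g)
  then show ?thesis
    using assms word_XBlock_Cons[of k g] by (simp add: nest_Suc)
qed (use assms in \<open>simp add: nest_Suc\<close>)

lemma turn_free_replicate: "successively may_precede (replicate k y)"
  by (induction k; cases y) (auto simp: may_precede_def successively_Cons hd_replicate)

lemma turn_free_nest:
  assumes "successively may_precede c" "balanced c" "c \<noteq> []"
  shows "successively may_precede (nest k c)"
  using assms balanced_hd[of c] balanced_last[of c] turn_free_replicate[of k]
  by (cases "k = 0") (simp_all add: nest_def successively_append_iff, simp add: may_precede_def)

lemma RB_word_word: "proper f \<Longrightarrow> RB_word (word f)"
proof -
  assume "proper f"
  then have "successively may_precede (word f)"
  proof (induction f)
    case (XBlock k f)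
    then show ?case
      by (simp add: successively_append_iff turn_free_replicate)
        (simp add: may_precede_def)
  next
    case (PBlock k c f)
    have "last (nest k (word c)) = RB"
      using PBlock by (auto simp: nest_def)
    moreover have "successively may_precede (nest k (word c))"
      using PBlock by (auto intro!: turn_free_nest simp: balanced_word word_eq_Nil_iff)
    moreover have "word f = [] \<or> hd (word f) = X"
      using PBlock.prems hd_word[of f] by (cases "f = Empty") (simp_all add: starts_X_iff)
    ultimately show ?case
      using PBlock by (auto simp: successively_append_iff may_precede_def)
  qed simp
  then show ?thesis by (simp add: RB_word_iff balanced_word)
qed

text \<open>
  The word is parsed letter by letter. A new leading \<open>x\<close> is added to the block that follows if
  that is an \<open>XBlock\<close>; a new leading pair of brackets is added to its content if that is a single
  \<open>PBlock\<close>. Otherwise it starts a block of length one.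
\<close>
lemma word_surj: "RB_word w \<Longrightarrow> \<exists>f. proper f \<and> word f = w"
proof (induction w rule: length_induct)
  case (1 w)
  have bal: "balanced w" and tf: "successively may_precede w"
    using 1(2) by (auto simp: RB_word_iff)
  have IH: "\<exists>f. proper f \<and> word f = c"
    if "length c < length w" "balanced c" "successively may_precede c" for c
    using that 1(1) by (simp add: RB_word_iff)
  show ?case
  proof (cases w)
    case Nil
    then show ?thesis by (intro exI[of _ Empty]) simp
  next
    case (Cons y w')
    then consider "y = X" | "y = LB" using balanced_hd[OF bal] by (cases y) auto
    then show ?thesis
    proof cases
      case 1
      then obtain f where f: "proper f" "word f = w'"
        using IH[of w'] bal tf Cons by (auto simp: balanced_X_Cons successively_Cons)
      show ?thesis
      proof (cases "starts_X f")
        case True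
        then obtain k g where "f = XBlock k g" by (cases f) auto
        then show ?thesis using f 1 Cons by (intro exI[of _ "XBlock (Suc k) g"]) auto
      next
        case False
        then show ?thesis using f 1 Cons by (intro exI[of _ "XBlock 1 f"]) auto
      qed
    next
      case 2
      then obtain c b where w': "w' = c @ RB # b" and c: "balanced c"
        using matching_bracket_exists[of "[]" w'] bal Cons by auto
      have w: "w = LB # c @ RB # b" using 2 Cons w' by simp
      have b: "balanced b" using bal c by (simp add: w balanced_bracket_append)
      have sep: "c \<noteq> []" "b = [] \<or> hd b \<noteq> LB"
        "successively may_precede c" "successively may_precede b"
        using tf by (auto simp: w successively_append_iff successively_Cons
            may_precede_def)
      obtain fc fb where f: "proper fc" "word fc = c" "proper fb" "word fb = b"
        using IH[of c] IH[of b] c b sep by (auto simp: w)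
      have fb: "\<not> starts_P fb"
        using sep(2) f hd_word[of fb] word_eq_Nil_iff[of fb]
        by (cases "fb = Empty") (auto simp: starts_X_iff)
      have fc: "fc \<noteq> Empty" using sep(1) f by auto
      show ?thesis
      proof (cases "single_P fc")
        case True
        then obtain k g where "fc = PBlock k g Empty" by (cases fc rule: single_P.cases) auto
        then show ?thesis
          using f fb by (intro exI[of _ "PBlock (Suc k) g fb"]) (auto simp: w nest_Suc)
      next
        case False
        then show ?thesis
          using f fb fc by (intro exI[of _ "PBlock 1 fc fb"]) (auto simp: w nest_Suc)
      qed
    qed
  qed
qed

lemma replicate_X_append_eq:
  assumes "replicate k X @ w = replicate l X @ w'"
    "w \<noteq> [] \<longrightarrow> hd w \<noteq> X" "w' \<noteq> [] \<longrightarrow> hd w' \<noteq> X"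
  shows "k = l \<and> w = w'"
  using assms
proof (induction k arbitrary: l)
  case 0
  then show ?case by (cases l) auto
next
  case (Suc k)
  then show ?case by (cases l) auto
qed

text \<open>
  If the two nesting depths differed, the content of the shallower block would itself be a nest,
  which maximality excludes.
\<close>
lemma nest_word_cancel:
  assumes "nest k (word c) = nest l (word d)" "k \<le> l" "proper c" "\<not> single_P c"
  shows "k = l \<and> word c = word d"
proof -
  have eq: "word c = nest (l - k) (word d)" using nest_eq_nest assms by blast
  have "l - k = 0"
  proof (rule ccontr)
    assume "l - k \<noteq> 0"
    then obtain i where "l - k = Suc i" using not0_implies_Suc by blast
    then show False using single_P_of_word_nest[of c i "word d"] assms eq by (simp add: balanced_word)
  qed
  then show ?thesis using assms eq by simp
qed

lemma word_inject: "proper f \<Longrightarrow> proper g \<Longrightarrow> word f = word g \<Longrightarrow> f = g"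
proof (induction f arbitrary: g)
  case Empty
  then show ?case using word_eq_Nil_iff[of g] by simp
next
  case (XBlock k f)
  have "hd (word g) = X" "g \<noteq> Empty"
    using XBlock.prems word_XBlock_Cons[of k f] by auto
  then obtain l g' where g: "g = XBlock l g'"
    using hd_word[of g] XBlock.prems by (cases g) auto
  have "k = l \<and> word f = word g'"
  proof (rule replicate_X_append_eq)
    show "word f \<noteq> [] \<longrightarrow> hd (word f) \<noteq> X" "word g' \<noteq> [] \<longrightarrow> hd (word g') \<noteq> X"
      using XBlock.prems g hd_word[of f] hd_word[of g'] by (cases "f = Empty"; cases "g' = Empty"; simp)+
  qed (use XBlock.prems g in simp)
  then show ?case using XBlock g by auto
next
  case (PBlock k c f)
  have "hd (word g) = LB" "g \<noteq> Empty"
    using PBlock.prems word_PBlock_Cons[of k c f] by auto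
  then obtain l d g' where g: "g = PBlock l d g'"
    using hd_word[of g] PBlock.prems by (cases g) auto
  have eq: "nest k (word c) = nest l (word d)" "word f = word g'"
    using PBlock.prems g nest_append_eq[of k "word c" "word f" l "word d" "word g'"]
    by (auto simp: balanced_word)
  have "k = l \<and> word c = word d"
  proof (cases "k \<le> l")
    case True
    then show ?thesis using nest_word_cancel[OF eq(1)] PBlock.prems by simp
  next
    case False
    then show ?thesis using nest_word_cancel[OF eq(1)[symmetric]] PBlock.prems g by simp
  qed
  then show ?case using PBlock g eq by auto
qed

lemma count_list_replicate: "count_list (replicate k x) x = k"
  by (induction k) auto

lemma count_word:
  "count_list (word f) LB = sum_list (p_exps f)"
  "count_list (word f) X = sum_list (x_exps f)"
  by (induction f) (simp_all add: nest_def count_list_replicate)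

lemma p_exps_factor: "k \<in> set (p_exps f) \<Longrightarrow> \<exists>a c b. word f = a @ nest k c @ b \<and> balanced c"
proof (induction f)
  case (XBlock l f)
  then obtain a c b where "word f = a @ nest k c @ b" "balanced c" by auto
  then show ?case by (intro exI[of _ "replicate l X @ a"] exI[of _ c] exI[of _ b]) simp
next
  case (PBlock l d f)
  then consider "k = l" | a c b where "word d = a @ nest k c @ b" "balanced c"
    | a c b where "word f = a @ nest k c @ b" "balanced c" by auto
  then show ?case
  proof cases
    case 1
    then show ?thesis
      by (intro exI[of _ "[]"] exI[of _ "word d"] exI[of _ "word f"]) (simp add: balanced_word)
  next
    case 2
    then show ?thesis
      by (intro exI[of _ "replicate l LB @ a"] exI[of _ c] exI[of _ "b @ replicate l RB @ word f"])
        (simp add: nest_def)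
  next
    case 3
    then show ?thesis
      by (intro exI[of _ "nest l (word d) @ a"] exI[of _ c] exI[of _ b]) simp
  qed
qed simp

text \<open>
  A nest in the word lies inside one block. Inside a \<open>PBlock\<close> it is either in the content or
  agrees with the \<open>l'\<close> inner pairs of the block; it cannot then be deeper than \<open>l'\<close>, as the
  content would again be a nest.
\<close>
lemma nest_factor_word:
  assumes "proper f" "word f = a @ nest k c @ b" "0 < k" "balanced c"
  shows "\<exists>l\<in>set (p_exps f). k \<le> l"
proof -
  have LB_in: "LB \<in> set (nest k c)" using \<open>0 < k\<close> by (simp add: nest_def)
  show ?thesis using assms(1,2)
  proof (induction f arbitrary: a b)
    case Empty
    then show ?case using LB_in by simp
  next
    case (XBlock l f)
    have "replicate l X @ word f = a @ nest k c @ b" using XBlock.prems by simp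
    then consider b' where "replicate l X = a @ nest k c @ b'" | a' where "word f = a' @ nest k c @ b"
      using nest_factor_append[OF _ balanced_replicate_X assms(4,3)] by blast
    then show ?case
    proof cases
      case 1
      then have "LB \<in> set (replicate l X)" using LB_in by simp
      then show ?thesis by simp
    next
      case 2
      then show ?thesis using XBlock by auto
    qed
  next
    case (PBlock l d f)
    have "nest l (word d) @ word f = a @ nest k c @ b" using PBlock.prems by simp
    then consider b' where "nest l (word d) = a @ nest k c @ b'"
      | a' where "word f = a' @ nest k c @ b"
      using nest_factor_append[OF _ balanced_nest[OF balanced_word] assms(4,3)] by blast
    then show ?case
    proof cases
      case 1
      then consider l' where "l' \<le> l" "nest l' (word d) = nest k c"
        | a'' b'' where "word d = a'' @ nest k c @ b''"
        using nest_factor_nest[OF _ balanced_word assms(4,3)] by blast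
      then show ?thesis
      proof cases
        case 1
        have "k \<le> l'"
        proof (rule ccontr)
          assume "\<not> k \<le> l'"
          then obtain i where "k - l' = Suc i" "l' \<le> k" by (metis Suc_diff_Suc linorder_le_cases not_le)
          then have "word d = nest (Suc i) c" using nest_eq_nest[OF 1(2)] by simp
          then show False using single_P_of_word_nest assms(4) PBlock.prems by auto
        qed
        then show ?thesis using 1 by auto
      next
        case 2
        then show ?thesis using PBlock.IH(1)[OF _ 2] PBlock.prems by auto
      qed
    next
      case 2
      then show ?thesis using PBlock.IH(2)[OF _ 2] PBlock.prems by auto
    qed
  qed
qed

lemma x_exps_factor: "k \<in> set (x_exps f) \<Longrightarrow> sublist (replicate k X) (word f)"
  by (induction f) (auto simp: nest_def sublist_append)

text \<open>
  Under the second assumption a block of equal letters cannot straddle the cut.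
\<close>
lemma sublist_replicate_append:
  assumes "sublist (replicate k x) (w @ w')" "w = [] \<or> last w \<noteq> x \<or> w' = [] \<or> hd w' \<noteq> x"
  shows "sublist (replicate k x) w \<or> sublist (replicate k x) w'"
proof -
  consider "sublist (replicate k x) w" | "sublist (replicate k x) w'"
    | p q where "replicate k x = p @ q" "suffix p w" "prefix q w'"
    using assms(1) by (auto simp: sublist_append)
  then show ?thesis
  proof cases
    case 3
    then have p: "set p \<subseteq> {x}" "set q \<subseteq> {x}"
      by (metis set_replicate_conv_if set_append Un_upper1 Un_upper2 subset_trans empty_subsetI order_refl)+
    have "p = [] \<or> q = []"
    proof (rule ccontr)
      assume "\<not> (p = [] \<or> q = [])"
      then have "last w = last p" "hd w' = hd q" "w \<noteq> []" "w' \<noteq> []"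
        using 3 by (auto simp: suffix_def prefix_def)
      moreover have "last p = x" "hd q = x"
        using p last_in_set[of p] hd_in_set[of q] \<open>\<not> (p = [] \<or> q = [])\<close> by blast+
      ultimately show False using assms(2) by auto
    qed
    then show ?thesis using 3 by auto
  qed auto
qed

lemma sublist_replicate_other: "sublist (replicate k x) (replicate l y) \<Longrightarrow> x \<noteq> y \<Longrightarrow> k = 0"
  using set_mono_sublist[of "replicate k x" "replicate l y"] by (cases "k = 0") (auto split: if_splits)

lemma X_factor_nest:
  assumes "sublist (replicate k X) (nest l c)" "0 < k"
  shows "sublist (replicate k X) c"
proof -
  have no_X: "\<not> sublist (replicate k X) (replicate l y)" if "y \<noteq> X" for y
    using sublist_replicate_other[of k X l y] assms(2) that by auto
  have "\<not> sublist (replicate k X) (replicate l LB)" by (rule no_X) simp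
  moreover have "replicate l LB = [] \<or> last (replicate l LB) \<noteq> X" by (cases "l = 0") simp_all
  ultimately have "sublist (replicate k X) (c @ replicate l RB)"
    using sublist_replicate_append[of k X "replicate l LB" "c @ replicate l RB"] assms(1)[unfolded nest_def] by argo
  moreover have "replicate l RB = [] \<or> hd (replicate l RB) \<noteq> X" by (cases "l = 0") simp_all
  ultimately show ?thesis
    using sublist_replicate_append[of k X c "replicate l RB"] no_X[of RB] by simp
qed

lemma X_factor_word:
  assumes "proper f" "sublist (replicate k X) (word f)" "0 < k"
  shows "\<exists>l\<in>set (x_exps f). k \<le> l"
  using assms(1,2)
proof (induction f)
  case Empty
  then show ?case using \<open>0 < k\<close> by simp
next
  case (XBlock l f)
  have "word f = [] \<or> hd (word f) \<noteq> X" using XBlock.prems hd_word[of f] by (cases "f = Empty") auto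
  then consider "sublist (replicate k X) (replicate l X)" | "sublist (replicate k X) (word f)"
    using sublist_replicate_append[of k X "replicate l X" "word f"] XBlock.prems by auto
  then show ?case
  proof cases
    case 1
    then have "k \<le> l" using sublist_length_le by fastforce
    then show ?thesis by simp
  qed (use XBlock in auto)
next
  case (PBlock l c f)
  have "last (nest l (word c)) \<noteq> X" using PBlock.prems by (simp add: nest_def)
  then consider "sublist (replicate k X) (nest l (word c))" | "sublist (replicate k X) (word f)"
    using sublist_replicate_append[of k X "nest l (word c)" "word f"] PBlock.prems by auto
  then show ?case
    using PBlock X_factor_nest[OF _ \<open>0 < k\<close>] by cases auto
qed

text \<open>
  The admissible lengths of a run of exponent \<open>u\<close>. Zero is excluded, so that a tree with maximal
  blocks and labels in this set is proper.
\<close>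
definition exponents :: "enat \<Rightarrow> nat set" where
  "exponents u = {k. 0 < k \<and> enat k \<le> u}"

definition bounded_blocks :: "enat \<Rightarrow> enat \<Rightarrow> blocks set" where
  "bounded_blocks u v =
     {f. maximal_blocks f \<and> set (p_exps f) \<subseteq> exponents u \<and> set (x_exps f) \<subseteq> exponents v}"

lemma bounded_blocks_proper: "f \<in> bounded_blocks u v \<Longrightarrow> proper f"
  by (auto simp: bounded_blocks_def proper_def exponents_def)

lemma word_in_RB_words_iff:
  assumes "proper f"
  shows "word f \<in> RB_words u v \<longleftrightarrow> f \<in> bounded_blocks u v"
proof -
  have p: "(\<forall>k a c b. 0 < k \<longrightarrow> word f = a @ nest k c @ b \<longrightarrow> balanced c \<longrightarrow> enat k \<le> u) \<longleftrightarrow>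
      (\<forall>k\<in>set (p_exps f). enat k \<le> u)" (is "?L \<longleftrightarrow> ?R")
  proof
    assume ?L
    then show ?R using p_exps_factor[of _ f] assms by (metis gr0I proper_def)
  next
    assume R: ?R
    show ?L
    proof (intro allI impI)
      fix k a c b assume "0 < k" "word f = a @ nest k c @ b" "balanced c"
      then obtain l where "l \<in> set (p_exps f)" "k \<le> l"
        using nest_factor_word assms by blast
      then show "enat k \<le> u" using R order_trans by (metis enat_ord_simps(1))
    qed
  qed
  have x: "(\<forall>k. 0 < k \<longrightarrow> sublist (replicate k X) (word f) \<longrightarrow> enat k \<le> v) \<longleftrightarrow>
      (\<forall>k\<in>set (x_exps f). enat k \<le> v)" (is "?L \<longleftrightarrow> ?R")
  proof
    assume ?L
    then show ?R using x_exps_factor[of _ f] assms by (metis gr0I proper_def)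
  next
    assume R: ?R
    show ?L
    proof (intro allI impI)
      fix k :: nat assume "0 < k" "sublist (replicate k X) (word f)"
      then obtain l where "l \<in> set (x_exps f)" "k \<le> l"
        using X_factor_word assms by blast
      then show "enat k \<le> v" using R order_trans by (metis enat_ord_simps(1))
    qed
  qed
  have "word f \<in> RB_words u v \<longleftrightarrow>
      (\<forall>k\<in>set (p_exps f). enat k \<le> u) \<and> (\<forall>k\<in>set (x_exps f). enat k \<le> v)"
    unfolding RB_words_def mem_Collect_eq P_runs_bounded_iff x_runs_bounded_iff p x
    using RB_word_word[OF assms] by simp
  moreover have "\<forall>k\<in>set (p_exps f) \<union> set (x_exps f). 0 < k"
    using assms unfolding proper_def by (metis Un_iff gr0I)
  ultimately show ?thesis
    using assms by (auto simp: bounded_blocks_def exponents_def proper_def)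
qed

lemma RB_words_eq: "RB_words u v = word ` bounded_blocks u v"
proof
  show "RB_words u v \<subseteq> word ` bounded_blocks u v"
  proof
    fix w assume w: "w \<in> RB_words u v"
    then obtain f where "proper f" "word f = w" using word_surj[of w] by (auto simp: RB_words_def)
    then show "w \<in> word ` bounded_blocks u v" using w word_in_RB_words_iff by blast
  qed
  show "word ` bounded_blocks u v \<subseteq> RB_words u v"
    using word_in_RB_words_iff bounded_blocks_proper by blast
qed

definition blocks_of_size :: "enat \<Rightarrow> enat \<Rightarrow> nat \<Rightarrow> nat \<Rightarrow> blocks set" where
  "blocks_of_size u v n m =
     {f \<in> bounded_blocks u v. sum_list (p_exps f) = n \<and> sum_list (x_exps f) = m}"

lemma inj_on_word: "inj_on word (bounded_blocks u v)"
  by (intro inj_onI word_inject bounded_blocks_proper)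

lemma r_count_eq: "r_count u v n m = card (blocks_of_size u v n m)"
proof -
  have "{w \<in> RB_words u v. degree w = n \<and> arity w = m} = word ` blocks_of_size u v n m"
    by (auto simp: RB_words_eq blocks_of_size_def degree_eq_count balanced_word arity_def count_word)
  moreover have "inj_on word (blocks_of_size u v n m)"
    by (rule inj_on_subset[OF inj_on_word[of u v]]) (auto simp: blocks_of_size_def)
  ultimately show ?thesis by (simp add: r_count_def card_image)
qed

text \<open>
  Degree and arity determine the length of a word, and the alphabet is finite. Without finiteness
  cardinalities would not add up, as \<open>card\<close> is zero on infinite sets.
\<close>
lemma finite_blocks_of_size: "finite (blocks_of_size u v n m)"
proof (rule inj_on_finite)
  show "inj_on word (blocks_of_size u v n m)"
    by (rule inj_on_subset[OF inj_on_word[of u v]]) (auto simp: blocks_of_size_def)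
  have "length w = count_list w X + count_list w LB + count_list w RB" for w
  proof (induction w)
    case (Cons y w)
    then show ?case by (cases y) auto
  qed simp
  then show "word ` blocks_of_size u v n m \<subseteq> {w. set w \<subseteq> {X, LB, RB} \<and> length w = 2 * n + m}"
    using letter.exhaust balanced_count[OF balanced_word]
    by (auto simp: blocks_of_size_def count_word)
  show "finite {w. set w \<subseteq> {X, LB, RB} \<and> length w = 2 * n + m}"
    by (rule finite_lists_length_eq) simp
qed

section \<open>Counting by skeletons\<close>

text \<open>
  The word of the skeleton is the collapsed word in \<open>R\<^bsub>1,1\<^esub>\<close>.
\<close>
fun skeleton :: "blocks \<Rightarrow> blocks" where
  "skeleton Empty = Empty"
| "skeleton (XBlock k f) = XBlock 1 (skeleton f)"
| "skeleton (PBlock k c f) = PBlock 1 (skeleton c) (skeleton f)"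

lemma skeleton_eq_Empty_iff [simp]: "skeleton f = Empty \<longleftrightarrow> f = Empty"
  by (cases f) auto

lemma skeleton_starts [simp]:
  "starts_X (skeleton f) = starts_X f" "starts_P (skeleton f) = starts_P f"
  by (cases f; simp)+

lemma single_P_iff: "single_P f \<longleftrightarrow> (\<exists>k c. f = PBlock k c Empty)"
  by (cases f rule: single_P.cases) auto

lemma single_P_skeleton [simp]: "single_P (skeleton f) = single_P f"
  by (cases f) (auto simp: single_P_iff)

lemma maximal_blocks_skeleton [simp]: "maximal_blocks (skeleton f) = maximal_blocks f"
  by (induction f) auto

lemma exps_skeleton:
  "p_exps (skeleton f) = replicate (length (p_exps f)) 1"
  "x_exps (skeleton f) = replicate (length (x_exps f)) 1"
  by (induction f) (simp_all add: replicate_add)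

lemma length_exps_cong:
  assumes "skeleton f = skeleton g"
  shows "length (p_exps f) = length (p_exps g)" "length (x_exps f) = length (x_exps g)"
  using exps_skeleton[of f] exps_skeleton[of g] assms by (metis length_replicate)+

text \<open>
  The label lists of a \<open>PBlock\<close> are concatenations; the skeleton determines where to cut them.
\<close>
lemma skeleton_labels_inject:
  "skeleton f = skeleton g \<Longrightarrow> p_exps f = p_exps g \<Longrightarrow> x_exps f = x_exps g \<Longrightarrow> f = g"
proof (induction f arbitrary: g)
  case Empty
  then show ?case by (cases g) auto
next
  case (XBlock k f)
  then show ?case by (cases g) auto
next
  case (PBlock k c f)
  then obtain d h where g: "g = PBlock k d h" by (cases g) auto
  have "length (p_exps c) = length (p_exps d)" "length (x_exps c) = length (x_exps d)"
    using length_exps_cong[of c d] PBlock.prems g by auto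
  then show ?case using PBlock g by auto
qed

lemma skeleton_labels_surj:
  assumes "skeleton s = s" "length ps = length (p_exps s)" "length xs = length (x_exps s)"
  shows "\<exists>f. skeleton f = s \<and> p_exps f = ps \<and> x_exps f = xs"
  using assms
proof (induction s arbitrary: ps xs)
  case Empty
  then show ?case by (intro exI[of _ Empty]) simp
next
  case (XBlock k s)
  then obtain l xs' where xs: "xs = l # xs'" by (cases xs) auto
  then obtain f where "skeleton f = s \<and> p_exps f = ps \<and> x_exps f = xs'"
    using XBlock.IH[of ps xs'] XBlock.prems by auto
  then show ?case using XBlock.prems xs by (intro exI[of _ "XBlock l f"]) simp
next
  case (PBlock k c s)
  then obtain l ps' where ps: "ps = l # ps'" by (cases ps) auto
  define i j where "i = length (p_exps c)" and "j = length (x_exps c)"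
  obtain d where d: "skeleton d = c \<and> p_exps d = take i ps' \<and> x_exps d = take j xs"
    using PBlock.IH(1)[of "take i ps'" "take j xs"] PBlock.prems ps by (auto simp: i_def j_def)
  obtain f where f: "skeleton f = s \<and> p_exps f = drop i ps' \<and> x_exps f = drop j xs"
    using PBlock.IH(2)[of "drop i ps'" "drop j xs"] PBlock.prems ps by (auto simp: i_def j_def)
  show ?case using d f PBlock.prems ps by (intro exI[of _ "PBlock l d f"]) simp
qed

lemma exponents_1: "exponents 1 = {1}"
  by (auto simp: exponents_def one_enat_def)

lemma skeleton_eq_self_iff:
  "skeleton f = f \<longleftrightarrow> set (p_exps f) \<subseteq> {1} \<and> set (x_exps f) \<subseteq> {1}"
  by (induction f) auto

text \<open>
  Compositions of \<open>n\<close> into \<open>i\<close> parts of size at most \<open>u\<close>.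
\<close>
definition bounded_lists :: "enat \<Rightarrow> nat \<Rightarrow> nat \<Rightarrow> nat list set" where
  "bounded_lists u i n = {l. length l = i \<and> sum_list l = n \<and> set l \<subseteq> exponents u}"

lemma finite_bounded_lists: "finite (bounded_lists u i n)"
proof (rule finite_subset)
  show "bounded_lists u i n \<subseteq> {l. set l \<subseteq> {..n} \<and> length l = i}"
    using member_le_sum_list by (auto simp: bounded_lists_def)
qed (simp add: finite_lists_length_eq)

lemma length_le_sum_list:
  fixes l :: "nat list"
  shows "set l \<subseteq> exponents u \<Longrightarrow> length l \<le> sum_list l"
  by (induction l) (auto simp: exponents_def)

text \<open>
  A tree corresponds to its skeleton together with its two label lists. For a skeleton all labels
  are \<open>1\<close>, so the number of labels of each kind is its degree \<open>i\<close>, respectively its arity \<open>j\<close>. The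
  bounds \<open>i \<le> n\<close> and \<open>j \<le> m\<close> hold because every label is at least \<open>1\<close>.
\<close>
lemma card_blocks_of_size:
  "card (blocks_of_size u v n m) =
     (\<Sum>i=0..n. \<Sum>j=0..m.
        card (blocks_of_size 1 1 i j) * card (bounded_lists u i n) * card (bounded_lists v j m))"
proof -
  let ?I = "{0..n} \<times> {0..m}"
  let ?A = "\<lambda>(i, j). blocks_of_size 1 1 i j \<times> bounded_lists u i n \<times> bounded_lists v j m"
  let ?h = "\<lambda>f. (skeleton f, p_exps f, x_exps f)"
  have "inj_on ?h (blocks_of_size u v n m)"
    using skeleton_labels_inject by (auto intro: inj_onI)
  moreover have "?h ` blocks_of_size u v n m = (\<Union>ij\<in>?I. ?A ij)"
  proof (intro equalityI subsetI)
    fix y assume "y \<in> ?h ` blocks_of_size u v n m"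
    then obtain f where y: "y = ?h f" and f: "f \<in> blocks_of_size u v n m" by blast
    define i j where "i = length (p_exps f)" and "j = length (x_exps f)"
    have "i \<le> n" "j \<le> m"
      using f length_le_sum_list[of "p_exps f" u] length_le_sum_list[of "x_exps f" v]
      by (auto simp: blocks_of_size_def bounded_blocks_def i_def j_def)
    moreover have "y \<in> ?A (i, j)"
      using f y by (auto simp: blocks_of_size_def bounded_blocks_def bounded_lists_def exps_skeleton
          sum_list_replicate exponents_1 i_def j_def)
    ultimately show "y \<in> (\<Union>ij\<in>?I. ?A ij)" by fastforce
  next
    fix y assume "y \<in> (\<Union>ij\<in>?I. ?A ij)"
    then obtain i j s ps xs where y: "y = (s, ps, xs)" and s: "s \<in> blocks_of_size 1 1 i j"
      and l: "ps \<in> bounded_lists u i n" "xs \<in> bounded_lists v j m" by auto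
    have s1: "skeleton s = s"
      using s by (auto simp: blocks_of_size_def bounded_blocks_def skeleton_eq_self_iff exponents_1)
    have "length (p_exps s) = i" "length (x_exps s) = j"
      using s exps_skeleton[of s] unfolding s1
      by (auto simp: blocks_of_size_def dest!: arg_cong[of _ _ sum_list] simp: sum_list_replicate)
    then obtain f where f: "skeleton f = s" "p_exps f = ps" "x_exps f = xs"
      using skeleton_labels_surj[OF s1] l by (auto simp: bounded_lists_def)
    have "maximal_blocks f"
      using s maximal_blocks_skeleton[of f] f by (simp add: blocks_of_size_def bounded_blocks_def)
    then have "f \<in> blocks_of_size u v n m"
      using l f by (auto simp: blocks_of_size_def bounded_blocks_def bounded_lists_def)
    then show "y \<in> ?h ` blocks_of_size u v n m" using y f by blast
  qed
  ultimately have "card (blocks_of_size u v n m) = card (\<Union>ij\<in>?I. ?A ij)"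
    using card_image[of ?h "blocks_of_size u v n m"] by simp
  also have "\<dots> = (\<Sum>ij\<in>?I. card (?A ij))"
  proof (rule card_UN_disjoint)
    show "\<forall>ij\<in>?I. finite (?A ij)"
      by (auto simp: finite_blocks_of_size finite_bounded_lists)
    show "\<forall>ij\<in>?I. \<forall>kl\<in>?I. ij \<noteq> kl \<longrightarrow> ?A ij \<inter> ?A kl = {}"
      by (auto simp: blocks_of_size_def)
  qed simp
  also have "\<dots> = (\<Sum>i=0..n. \<Sum>j=0..m.
        card (blocks_of_size 1 1 i j) * card (bounded_lists u i n) * card (bounded_lists v j m))"
    by (simp add: sum.cartesian_product card_cartesian_product mult.assoc split_def)
  finally show ?thesis .
qed

section \<open>Generating functions\<close>

lemma G1_nth: "fps_nth (G1 u) n = of_bool (n \<in> exponents u)"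
proof (cases u)
  case (enat k)
  have "(1 - fps_X ^ k) / (1 - fps_X :: rat fps) = (\<Sum>i<k. fps_X ^ i)"
    by (simp add: one_diff_power_eq)
  then show ?thesis
    by (auto simp: G1_def enat exponents_def fps_sum_nth)
next
  case infinity
  have "fps_X / (1 - fps_X :: rat fps) = fps_X * Abs_fps (\<lambda>_. 1)"
    by (simp add: fps_divide_unit fps_inverse_one_minus_fps_X)
  then show ?thesis
    by (auto simp: G1_def infinity exponents_def)
qed

text \<open>
  Multiplying by another factor of \<open>G\<^bsub>1,u\<^esub>\<close> prepends a further part to the composition.
\<close>
lemma G1_power_nth: "fps_nth (G1 u ^ i) n = of_nat (card (bounded_lists u i n))"
proof (induction i arbitrary: n)
  case 0
  have "bounded_lists u 0 n = (if n = 0 then {[]} else {})"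
    by (auto simp: bounded_lists_def)
  then show ?case by simp
next
  case (Suc i)
  let ?A = "\<lambda>k. if k \<in> exponents u then Cons k ` bounded_lists u i (n - k) else {}"
  have "bounded_lists u (Suc i) n = (\<Union>k\<in>{0..n}. ?A k)"
  proof (intro equalityI subsetI)
    fix l assume l: "l \<in> bounded_lists u (Suc i) n"
    then obtain k l' where "l = k # l'" by (cases l) (auto simp: bounded_lists_def)
    then have "k \<in> {0..n}" "l \<in> ?A k" using l by (auto simp: bounded_lists_def)
    then show "l \<in> (\<Union>k\<in>{0..n}. ?A k)" by blast
  qed (auto simp: bounded_lists_def split: if_splits)
  also have "card \<dots> = (\<Sum>k=0..n. card (?A k))"
    by (rule card_UN_disjoint) (auto simp: finite_bounded_lists)
  finally have "(of_nat (card (bounded_lists u (Suc i) n)) :: rat) = of_nat (\<Sum>k=0..n. card (?A k))"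
    by simp
  also have "\<dots> = (\<Sum>k=0..n. fps_nth (G1 u) k * fps_nth (G1 u ^ i) (n - k))"
    unfolding of_nat_sum by (intro sum.cong refl) (auto simp: Suc.IH G1_nth card_image)
  finally show ?case by (simp add: fps_mult_nth)
qed

lemma G1_1: "G1 1 = fps_X"
  by (rule fps_ext) (simp add: G1_nth exponents_1)

lemma R_gf_eq: "R_gf u v = fps_subst2 (R_gf 1 1) (G1 u) (G1 v)"
proof (intro fps_ext)
  fix n m
  show "fps_nth (fps_nth (R_gf u v) n) m =
      fps_nth (fps_nth (fps_subst2 (R_gf 1 1) (G1 u) (G1 v)) n) m"
    unfolding fps_subst2_nth G1_power_nth
    by (simp add: R_gf_def r_count_eq card_blocks_of_size[of u v])
qed

theorem theorem4p4:
  fixes u v :: enat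
  assumes "1 \<le> u" and "1 \<le> v"
  shows "R_gf u 1 = fps_subst2 (R_gf 1 1) (G1 u) fps_X \<and>
         R_gf 1 v = fps_subst2 (R_gf 1 1) fps_X (G1 v) \<and>
         R_gf u v = fps_subst2 (R_gf 1 1) (G1 u) (G1 v)"
  using R_gf_eq[of u 1] R_gf_eq[of 1 v] R_gf_eq[of u v] by (simp only: G1_1 simp_thms)

end
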